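(* Let $G$ be a finite set of finite sets and let $h: G\to\{-1,1\}$ be any function. Then $\det(L)=\det(g)=\prod_{x\in G}h(x)\in\{-1,1\}$, and the integer matrices $L^{++}$, $L^{--}$, $L=L^{--}$ and $g=SL^{++}S$ are all unimodular (i.e. have determinant $1$ or $-1$).
   Context: For $x\in G$ let $W^+(x)=\{y\in G: x\subset y\}$ and $W^-(x)=\{y\in G: y\subset x\}$ (both include $x$). Let $|x|$ be the cardinality of $x$, $\dim(x)=|x|-1$ and $\omega(x)=(-1)^{\dim(x)}$. For a function $h$ on $G$ and $A\subset G$ put $E[A]=\sum_{x\in A}h(x)$ (with $E[\emptyset]=0$). The matrices, indexed by $G\times G$, are $L^{--}(x,y)=E[W^-(x)\cap W^-(y)]$, $L^{++}(x,y)=E[W^+(x)\cap W^+(y)]$, and $S(x,y)=\omega(x)$ if $x=y$ and $0$ otherwise. Set $L=L^{--}$ and $g=SL^{++}S$. No closure property of $G$ under subsets is assumed. *)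

theory Defs
  imports "Jordan_Normal_Form.Determinant"
begin

definition W_plus :: "'a set set \<Rightarrow> 'a set \<Rightarrow> 'a set set" where
  "W_plus G x = {y \<in> G. x \<subseteq> y}"

definition W_minus :: "'a set set \<Rightarrow> 'a set \<Rightarrow> 'a set set" where
  "W_minus G x = {y \<in> G. y \<subseteq> x}"

(* An integer, so that the empty set, which may belong to G, has dimension -1. *)
definition sdim :: "'a set \<Rightarrow> int" where
  "sdim x = int (card x) - 1"

(* (-1)^sdim x, where the exponent may be -1; in particular omega {} = -1. *)
definition omega :: "'a set \<Rightarrow> int" where
  "omega x = (if even (sdim x) then 1 else - 1)"

definition energy :: "('a set \<Rightarrow> int) \<Rightarrow> 'a set set \<Rightarrow> int" where
  "energy h A = (\<Sum>x\<in>A. h x)"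

(* A matrix indexed by G x G is represented along an enumeration xs of G, i.e. a list
   with distinct xs and set xs = G: row and column i belong to the element xs ! i. *)
definition mat_along :: "'i list \<Rightarrow> ('i \<Rightarrow> 'i \<Rightarrow> int) \<Rightarrow> int mat" where
  "mat_along xs F = mat (length xs) (length xs) (\<lambda>(i, j). F (xs ! i) (xs ! j))"

definition L_minus :: "'a set list \<Rightarrow> ('a set \<Rightarrow> int) \<Rightarrow> int mat" where
  "L_minus xs h =
     mat_along xs (\<lambda>x y. energy h (W_minus (set xs) x \<inter> W_minus (set xs) y))"

definition L_plus :: "'a set list \<Rightarrow> ('a set \<Rightarrow> int) \<Rightarrow> int mat" where
  "L_plus xs h =
     mat_along xs (\<lambda>x y. energy h (W_plus (set xs) x \<inter> W_plus (set xs) y))"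

definition S_mat :: "'a set list \<Rightarrow> int mat" where
  "S_mat xs = mat_along xs (\<lambda>x y. if x = y then omega x else 0)"

definition g_mat :: "'a set list \<Rightarrow> ('a set \<Rightarrow> int) \<Rightarrow> int mat" where
  "g_mat xs h = S_mat xs * L_plus xs h * S_mat xs"

definition unimodular :: "int mat \<Rightarrow> bool" where
  "unimodular A \<longleftrightarrow> square_mat A \<and> det A \<in> {1, - 1}"

end

theory Submission
  imports Defs
begin

text \<open>
  Both energy matrices are Gram matrices of the incidence relation. Put
  \<open>Z(x, y) = 1\<close> if \<open>x \<subseteq> y\<close> and \<open>0\<close> otherwise, and let \<open>H\<close> be the diagonal matrix of
  \<open>h\<close>. Since \<open>E[W\<^sup>-(x) \<inter> W\<^sup>-(y)]\<close> adds \<open>h(z)\<close> over the \<open>z\<close> contained in both \<open>x\<close> and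
  \<open>y\<close>, it is the \<open>(x, y)\<close> entry of \<open>Z\<^sup>T H Z\<close>; dually, \<open>L\<^sup>+\<^sup>+ = Z H Z\<^sup>T\<close>.

  In an enumeration of \<open>G\<close> by cardinality \<open>Z\<close> would be unitriangular, so \<open>det Z = 1\<close> and
  both determinants equal \<open>det H\<close>, the product of the values of \<open>h\<close>. The given enumeration
  is arbitrary, but no reordering is needed: in the Leibniz expansion a permutation that
  contributes moves no element to one of smaller rank, hence preserves all ranks, hence is
  the identity (\<open>det_mat_along_graded\<close>). Finally, conjugating with \<open>S\<close> multiplies
  the determinant by \<open>(det S)\<^sup>2 = 1\<close>.
\<close>

lemma mat_along_carrier [simp]:
  "mat_along xs F \<in> carrier_mat (length xs) (length xs)"
  by (simp add: mat_along_def)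

lemma transpose_mat_along:
  "transpose_mat (mat_along xs F) = mat_along xs (\<lambda>x y. F y x)"
  by (rule eq_matI) (auto simp: mat_along_def)

lemma mat_along_mult:
  assumes "distinct xs"
  shows "mat_along xs F * mat_along xs K = mat_along xs (\<lambda>x y. \<Sum>z\<in>set xs. F x z * K z y)"
proof -
  have "(\<Sum>z\<in>set xs. f z) = (\<Sum>k = 0..<length xs. f (xs ! k))" for f :: "'a \<Rightarrow> int"
    using assms by (simp add: sum.distinct_set_conv_list sum_list_sum_nth)
  then show ?thesis
    by (intro eq_matI) (auto simp: mat_along_def scalar_prod_def)
qed

text \<open>
  The permutation of indices in a nonzero Leibniz term never lowers the rank. The ranks
  along the permutation have the same sum as before, so none is raised either, and then
  the hypothesis leaves only the diagonal entries.
\<close>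

lemma det_mat_along_graded:
  fixes r :: "'i \<Rightarrow> int"
  assumes "distinct xs"
    and graded: "\<And>x y. x \<in> set xs \<Longrightarrow> y \<in> set xs \<Longrightarrow> F x y \<noteq> 0 \<Longrightarrow> x = y \<or> r x < r y"
  shows "det (mat_along xs F) = (\<Prod>x\<in>set xs. F x x)"
proof -
  let ?n = "length xs"
  let ?t = "\<lambda>p. signof p * (\<Prod>i = 0..<?n. F (xs ! i) (xs ! p i)) :: int"
  have zero: "?t p = 0" if p: "p permutes {0..<?n}" and "p \<noteq> id" for p
  proof (rule ccontr)
    assume "?t p \<noteq> 0"
    then have nz: "F (xs ! i) (xs ! p i) \<noteq> 0" if "i < ?n" for i
      using that by auto
    have lt: "p i < ?n" if "i < ?n" for i
      using permutes_in_image[OF p, of i] that by auto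
    have step: "i = p i \<or> r (xs ! i) < r (xs ! p i)" if "i < ?n" for i
      using graded[OF _ _ nz[OF that]] lt[OF that] that nth_eq_iff_index_eq[OF assms(1)]
      by auto
    from \<open>p \<noteq> id\<close> obtain j where j: "p j \<noteq> j" by (auto simp: fun_eq_iff)
    then have "j < ?n" using permutes_not_in[OF p, of j] by auto
    have "(\<Sum>i = 0..<?n. r (xs ! i)) < (\<Sum>i = 0..<?n. r (xs ! p i))"
      using step j \<open>j < ?n\<close> by (intro sum_strict_mono_ex1) force+
    moreover have "(\<Sum>i = 0..<?n. r (xs ! p i)) = (\<Sum>i = 0..<?n. r (xs ! i))"
      using sum.permute[OF p, of "\<lambda>i. r (xs ! i)"] by (simp add: o_def)
    ultimately show False by simp
  qed
  have "det (mat_along xs F) = (\<Sum>p | p permutes {0..<?n}. ?t p)"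
    unfolding det_def'[OF mat_along_carrier]
  proof (intro sum.cong refl arg_cong2[where f = "(*)"] prod.cong)
    fix p i assume "p \<in> {p. p permutes {0..<?n}}" and "i \<in> {0..<?n}"
    then show "mat_along xs F $$ (i, p i) = F (xs ! i) (xs ! p i)"
      using permutes_in_image[of p "{0..<?n}" i] by (simp add: mat_along_def)
  qed
  also have "\<dots> = (\<Sum>p\<in>{id}. ?t p)"
    using zero by (intro sum.mono_neutral_right) (auto simp: finite_permutations permutes_id)
  also have "\<dots> = (\<Prod>x\<in>set xs. F x x)"
    using prod.reindex_bij_betw[OF bij_betw_nth[OF assms(1) refl refl], of "\<lambda>x. F x x"]
    by (simp add: sign_id lessThan_atLeast0)
  finally show ?thesis .
qed

lemma det_mat_along_diag:
  assumes "distinct xs"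
  shows "det (mat_along xs (\<lambda>x y. if x = y then d x else 0)) = (\<Prod>x\<in>set xs. d x)"
  by (subst det_mat_along_graded[OF assms, where r = "\<lambda>_. 0"]) (auto split: if_splits)

text \<open>
  The matrix is \<open>F H F\<^sup>T\<close> with \<open>H\<close> diagonal, and \<open>F\<close> has determinant \<open>1\<close>.
\<close>

lemma det_weighted_gram_unitriangular:
  fixes r :: "'i \<Rightarrow> int"
  assumes "distinct xs"
    and graded: "\<And>x y. x \<in> set xs \<Longrightarrow> y \<in> set xs \<Longrightarrow> F x y \<noteq> 0 \<Longrightarrow> x = y \<or> r x < r y"
    and unit: "\<And>x. x \<in> set xs \<Longrightarrow> F x x = 1"
  shows "det (mat_along xs (\<lambda>x y. \<Sum>z\<in>set xs. F x z * h z * F y z)) = (\<Prod>x\<in>set xs. h x)"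
proof -
  let ?F = "mat_along xs F"
  let ?H = "mat_along xs (\<lambda>x y. if x = y then h x else 0)"
  have F: "det ?F = 1"
    using det_mat_along_graded[OF assms(1) graded] unit by simp
  have "?F * ?H = mat_along xs (\<lambda>x z. F x z * h z)"
    unfolding mat_along_mult[OF assms(1)]
    by (rule eq_matI) (auto simp: mat_along_def if_distrib cong: if_cong)
  then have "mat_along xs (\<lambda>x y. \<Sum>z\<in>set xs. F x z * h z * F y z) = ?F * ?H * transpose_mat ?F"
    by (simp add: transpose_mat_along mat_along_mult[OF assms(1)])
  also have "det \<dots> = det ?F * det ?H * det (transpose_mat ?F)"
    by (simp add: det_mult[where n = "length xs"] mult_carrier_mat[where n = "length xs"])
  also have "\<dots> = (\<Prod>x\<in>set xs. h x)"
    by (simp add: F det_transpose[where n = "length xs"] det_mat_along_diag[OF assms(1)])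
  finally show ?thesis .
qed

lemma energy_filter:
  assumes "finite G"
  shows "energy h {z \<in> G. P z \<and> Q z} = (\<Sum>z\<in>G. of_bool (P z) * h z * of_bool (Q z))"
  unfolding energy_def sum.inter_filter[OF assms] by (rule sum.cong) auto

lemma det_L_plus:
  assumes "distinct xs" and fin: "\<And>x. x \<in> set xs \<Longrightarrow> finite x"
  shows "det (L_plus xs h) = (\<Prod>x\<in>set xs. h x)"
proof -
  have "W_plus (set xs) x \<inter> W_plus (set xs) y = {z \<in> set xs. x \<subseteq> z \<and> y \<subseteq> z}" for x y
    by (auto simp: W_plus_def)
  moreover have "x = y \<or> int (card x) < int (card y)"
    if "y \<in> set xs" "x \<subseteq> y" for x y
    using psubset_card_mono[OF fin[OF that(1)], of x] that by auto
  ultimately show ?thesis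
    using det_weighted_gram_unitriangular
        [OF assms(1), of "\<lambda>x z. of_bool (x \<subseteq> z)" "\<lambda>x. int (card x)" h]
    by (simp add: L_plus_def energy_filter)
qed

text \<open>
  Here the incidence factor is nonzero at \<open>(x, z)\<close> only for subsets \<open>z\<close> of \<open>x\<close>, so
  the rank that increases along it is the negated cardinality.
\<close>

lemma det_L_minus:
  assumes "distinct xs" and fin: "\<And>x. x \<in> set xs \<Longrightarrow> finite x"
  shows "det (L_minus xs h) = (\<Prod>x\<in>set xs. h x)"
proof -
  have "W_minus (set xs) x \<inter> W_minus (set xs) y = {z \<in> set xs. z \<subseteq> x \<and> z \<subseteq> y}" for x y
    by (auto simp: W_minus_def)
  moreover have "x = y \<or> - int (card x) < - int (card y)"
    if "x \<in> set xs" "y \<subseteq> x" for x y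
    using psubset_card_mono[OF fin[OF that(1)], of y] that by auto
  ultimately show ?thesis
    using det_weighted_gram_unitriangular
        [OF assms(1), of "\<lambda>x z. of_bool (z \<subseteq> x)" "\<lambda>x. - int (card x)" h]
    by (simp add: L_minus_def energy_filter)
qed

lemma det_g_mat:
  assumes "distinct xs"
  shows "det (g_mat xs h) = det (L_plus xs h)"
proof -
  have S: "S_mat xs \<in> carrier_mat (length xs) (length xs)"
    and L: "L_plus xs h \<in> carrier_mat (length xs) (length xs)"
    by (simp_all add: S_mat_def L_plus_def)
  have "det (S_mat xs) * det (S_mat xs) = (\<Prod>x\<in>set xs. omega x * omega x)"
    unfolding S_mat_def det_mat_along_diag[OF assms] by (simp add: prod.distrib)
  also have "\<dots> = 1"
    by (intro prod.neutral) (simp add: omega_def)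
  finally have square: "det (S_mat xs) * det (S_mat xs) = 1" .
  have "det (g_mat xs h) = det (S_mat xs) * det (L_plus xs h) * det (S_mat xs)"
    unfolding g_mat_def
    by (simp add: det_mult[OF mult_carrier_mat[OF S L] S] det_mult[OF S L])
  also have "\<dots> = det (L_plus xs h)"
    using square by (simp add: mult.assoc mult.left_commute)
  finally show ?thesis .
qed

lemma prod_signs:
  fixes h :: "'i \<Rightarrow> int"
  assumes "\<forall>x\<in>A. h x \<in> {- 1, 1}"
  shows "(\<Prod>x\<in>A. h x) \<in> {- 1, 1}"
  using assms by (induction A rule: infinite_finite_induct) auto

theorem corollary1:
  fixes G :: "'a set set" and h :: "'a set \<Rightarrow> int" and xs :: "'a set list"
  assumes "finite G"
    and "\<forall>x\<in>G. finite x"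
    and "\<forall>x\<in>G. h x \<in> {- 1, 1}"
    and "distinct xs" and "set xs = G"
  shows "det (L_minus xs h) = (\<Prod>x\<in>G. h x)
    \<and> det (g_mat xs h) = (\<Prod>x\<in>G. h x)
    \<and> (\<Prod>x\<in>G. h x) \<in> {- 1, 1}
    \<and> unimodular (L_plus xs h)
    \<and> unimodular (L_minus xs h)
    \<and> unimodular (g_mat xs h)"
proof -
  have "det (L_plus xs h) = (\<Prod>x\<in>G. h x)" "det (L_minus xs h) = (\<Prod>x\<in>G. h x)"
    using det_L_plus[OF assms(4)] det_L_minus[OF assms(4)] assms(2,5) by auto
  moreover have "det (g_mat xs h) = det (L_plus xs h)"
    by (rule det_g_mat[OF assms(4)])
  moreover have "(\<Prod>x\<in>G. h x) \<in> {- 1, 1}"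
    by (rule prod_signs[OF assms(3)])
  moreover have "square_mat (L_plus xs h)" "square_mat (L_minus xs h)" "square_mat (g_mat xs h)"
    by (simp_all add: g_mat_def S_mat_def L_plus_def L_minus_def mat_along_def)
  ultimately show ?thesis
    by (auto simp: unimodular_def)
qed

end
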